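(* Consider matrices $A\in\mathbb{R}^{d\times d}$, $B\in\mathbb{R}^{d\times n}$, $D\in\mathbb{R}^{d\times d}$, where $D$ is invertible. Let $F,G\subseteq\mathbb{R}^d\times\mathbb{R}^d\times\mathbb{R}^n\times\mathbb{S}^{d\times d}\times\mathbb{S}^{(d+n)\times(d+n)}$ be defined by $$ F=\left\{(y,x,q,M_1,M_2)\;\middle|\; Dy=Ax+Bq,\; M_1=yy^T,\; M_2=\begin{bmatrix}x\\ q\end{bmatrix}\begin{bmatrix}x\\ q\end{bmatrix}^T\right\}, $$ $$ G=\left\{(y,x,q,M_1,M_2)\;\middle|\; \begin{array}{l} Dy=Ax+Bq,\\ DM_1D^T=\begin{bmatrix}A & B\end{bmatrix}M_2\begin{bmatrix}A^T\\ B^T\end{bmatrix},\\ \begin{bmatrix}M_1 & y\\ y^T & 1\end{bmatrix}\succeq 0,\quad \begin{bmatrix}M_2 & \begin{bmatrix}x\\ q\end{bmatrix}\\ \begin{bmatrix}x^T & q^T\end{bmatrix} & 1\end{bmatrix}\succeq 0 \end{array}\right\}. $$ Then $F\subseteq G$.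
   Context: $\mathbb{S}^{m\times m}$ denotes the set of real symmetric $m\times m$ matrices, and $\succeq 0$ means positive semidefinite. *)

theory Defs
  imports "HOL-Analysis.Analysis"
begin

text \<open>
  Block matrices are indexed by sum types: an index \<open>Inl i\<close> refers to the first block,
  an index \<open>Inr j\<close> to the second one. In \<^typ>\<open>real^'n^'m\<close> the rows are indexed by \<open>'m\<close> and the
  columns by \<open>'n\<close>, so a matrix in $R^{d \times n}$ is a \<^typ>\<open>real^'n^'d\<close>.
\<close>

definition hcat :: "'a^'n1^'m \<Rightarrow> 'a^'n2^'m \<Rightarrow> 'a^('n1 + 'n2)^'m" where
  "hcat P Q = (\<chi> i j. case j of Inl k \<Rightarrow> P $ i $ k | Inr k \<Rightarrow> Q $ i $ k)"

definition vcat :: "'a^'n^'m1 \<Rightarrow> 'a^'n^'m2 \<Rightarrow> 'a^'n^('m1 + 'm2)" where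
  "vcat P Q = (\<chi> i. case i of Inl k \<Rightarrow> P $ k | Inr k \<Rightarrow> Q $ k)"

definition block_matrix ::
    "'a^'n1^'m1 \<Rightarrow> 'a^'n2^'m1 \<Rightarrow> 'a^'n1^'m2 \<Rightarrow> 'a^'n2^'m2 \<Rightarrow> 'a^('n1 + 'n2)^('m1 + 'm2)" where
  "block_matrix P Q R S = vcat (hcat P Q) (hcat R S)"

definition symmetric_matrices :: "(real^'m^'m) set" where
  "symmetric_matrices = {M. transpose M = M}"

definition psd :: "real^'m^'m \<Rightarrow> bool" where
  "psd M \<longleftrightarrow> M \<in> symmetric_matrices \<and> (\<forall>v. 0 \<le> v \<bullet> (M *v v))"

text \<open>
  The number of columns of \<open>columnvector v\<close> is a free type variable (all columns are equal to
  \<open>v\<close>), so it has to be fixed to \<open>1\<close> explicitly.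
\<close>

abbreviation col :: "real^'m \<Rightarrow> real^1^'m" where
  "col v \<equiv> columnvector v"

text \<open>
  The scalar entry \<open>1\<close> of a bordered matrix is the \<open>1 \<times> 1\<close> identity \<open>mat 1\<close>; the stacked
  vector of \<open>x\<close> and \<open>q\<close> is kept as the one-column matrix
  \<open>vcat (col x) (col q)\<close>.
\<close>

definition set_F ::
    "real^'d^'d \<Rightarrow> real^'n^'d \<Rightarrow> real^'d^'d \<Rightarrow>
     ((real^'d) \<times> (real^'d) \<times> (real^'n) \<times> (real^'d^'d) \<times> (real^('d + 'n)^('d + 'n))) set" where
  "set_F A B D = {(y, x, q, M1, M2).
     M1 \<in> symmetric_matrices \<and> M2 \<in> symmetric_matrices \<and>
     D *v y = A *v x + B *v q \<and>
     M1 = col y ** transpose (col y) \<and>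
     M2 = vcat (col x) (col q)
            ** transpose (vcat (col x) (col q))}"

definition set_G ::
    "real^'d^'d \<Rightarrow> real^'n^'d \<Rightarrow> real^'d^'d \<Rightarrow>
     ((real^'d) \<times> (real^'d) \<times> (real^'n) \<times> (real^'d^'d) \<times> (real^('d + 'n)^('d + 'n))) set" where
  "set_G A B D = {(y, x, q, M1, M2).
     M1 \<in> symmetric_matrices \<and> M2 \<in> symmetric_matrices \<and>
     D *v y = A *v x + B *v q \<and>
     D ** M1 ** transpose D = hcat A B ** M2 ** vcat (transpose A) (transpose B) \<and>
     psd (block_matrix M1 (col y)
            (transpose (col y)) (mat 1 :: real^1^1)) \<and>
     psd (block_matrix M2 (vcat (col x) (col q))
            (hcat (transpose (col x)) (transpose (col q)))
            (mat 1 :: real^1^1))}"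

end

theory Submission
  imports Defs
begin

text \<open>
  A point of \<^term>\<open>set_F A B D\<close> has moment matrices of rank one, and every constraint of
  \<^term>\<open>set_G A B D\<close> says something about outer products. Write \<open>w\<close> for the stacked column of
  \<open>x\<close> and \<open>q\<close>. Since \<open>M1 = y y\<^sup>T\<close> and \<open>M2 = w w\<^sup>T\<close>, the quadratic constraint equates the outer
  squares of the columns \<open>D y\<close> and \<open>[A B] w = A x + B q\<close>, which agree by the linear constraint.
  Each bordered matrix is itself an outer square, namely that of the column (\<open>y\<close> or \<open>w\<close>) extended
  by a last entry \<open>1\<close> (lemma \<open>block_matrix_gram\<close>), hence positive semidefinite
  (lemma \<open>psd_gram\<close>).
\<close>

lemma transpose_vcat: "transpose (vcat P Q) = hcat (transpose P) (transpose Q)"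
  by (simp add: vec_eq_iff transpose_def vcat_def hcat_def split: sum.split)

lemma transpose_hcat: "transpose (hcat P Q) = vcat (transpose P) (transpose Q)"
  by (simp add: vec_eq_iff transpose_def vcat_def hcat_def split: sum.split)

lemma hcat_mul_vcat:
  fixes P :: "'a::semiring_1^'n1^'m" and Q :: "'a^'n2^'m"
  shows "hcat P Q ** vcat R S = P ** R + Q ** S"
  by (simp add: vec_eq_iff matrix_matrix_mult_def vcat_def hcat_def
      UNIV_Plus_UNIV [symmetric] sum.Plus del: UNIV_Plus_UNIV)

lemma vcat_mul_hcat:
  fixes P :: "'a::semiring_1^'n^'m1" and Q :: "'a^'n^'m2"
  shows "vcat P Q ** hcat R S = block_matrix (P ** R) (P ** S) (Q ** R) (Q ** S)"
  by (simp add: vec_eq_iff matrix_matrix_mult_def block_matrix_def vcat_def hcat_def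
      split: sum.split)

lemma matrix_mul_columnvector: "A ** columnvector v = columnvector (A *v v)"
  by (simp add: vec_eq_iff matrix_matrix_mult_def matrix_vector_mult_def columnvector_def)

lemma columnvector_add: "columnvector u + columnvector v = columnvector (u + v)"
  by (simp add: vec_eq_iff columnvector_def)

text \<open>The quadratic form of \<open>W W\<^sup>T\<close> at \<open>v\<close> is the squared norm of \<open>W\<^sup>T v\<close>.\<close>

lemma psd_gram:
  fixes W :: "real^'k^'m"
  shows "psd (W ** transpose W)"
proof -
  have "v \<bullet> ((W ** transpose W) *v v) = (transpose W *v v) \<bullet> (transpose W *v v)" for v
    by (metis dot_lmul_matrix matrix_vector_mul_assoc transpose_matrix_vector)
  then show ?thesis
    by (simp add: psd_def symmetric_matrices_def matrix_transpose_mul)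
qed

lemma block_matrix_gram:
  fixes C :: "real^'k^'m"
  shows "block_matrix (C ** transpose C) C (transpose C) (mat 1)
    = vcat C (mat 1) ** transpose (vcat C (mat 1))"
  by (simp add: transpose_vcat vcat_mul_hcat transpose_mat)

text \<open>
  This turns the quadratic constraint of \<^const>\<open>set_G\<close> into an equation between outer squares.
\<close>

lemma congruence_gram:
  fixes P :: "real^'m^'l" and C :: "real^'k^'m"
  shows "P ** (C ** transpose C) ** transpose P = (P ** C) ** transpose (P ** C)"
  by (simp add: matrix_transpose_mul matrix_mul_assoc)

theorem proposition4p2:
  fixes A D :: "real^'d^'d" and B :: "real^'n^'d"
  assumes "invertible D"
  shows "set_F A B D \<subseteq> set_G A B D"
proof -
  have "(y, x, q, M1, M2) \<in> set_G A B D" if F: "(y, x, q, M1, M2) \<in> set_F A B D" for y x q M1 M2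
  proof -
    define w where "w = vcat (col x) (col q)"
    have lin: "D *v y = A *v x + B *v q"
      and sym: "M1 \<in> symmetric_matrices" "M2 \<in> symmetric_matrices"
      and M1: "M1 = col y ** transpose (col y)" and M2: "M2 = w ** transpose w"
      using F by (auto simp: set_F_def w_def)
    have "hcat A B ** w = D ** col y"
      by (simp add: w_def hcat_mul_vcat matrix_mul_columnvector columnvector_add lin)
    then have quad: "D ** M1 ** transpose D = hcat A B ** M2 ** vcat (transpose A) (transpose B)"
      unfolding M1 M2 transpose_hcat [symmetric] congruence_gram by simp
    have "psd (block_matrix M1 (col y) (transpose (col y)) (mat 1))"
      unfolding M1 block_matrix_gram by (rule psd_gram)
    moreover have "psd (block_matrix M2 w (transpose w) (mat 1))"
      unfolding M2 block_matrix_gram by (rule psd_gram)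
    ultimately show ?thesis
      using lin sym quad by (simp add: set_G_def w_def transpose_vcat)
  qed
  then show ?thesis
    by auto
qed

end
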